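(* Fix an integer $k\geq 2$ and $\epsilon>0$. There exists a finitely supported probability distribution $\mu$ on the collection of finite sets $E\subseteq\mathbf{N}$ with at least $k$ elements such that, for all $1\leq i\leq k$, the push-forward distribution $\alpha_i(\mu)$ is $\epsilon$-close to $\mu$ in total variation distance.
   Context: $\mathbf{N}=\{1,2,\ldots\}$. For a finite set $E=\{y_1<\cdots<y_n\}\subseteq\mathbf{N}$ and $1\leq i\leq n$, $\alpha_i(E)=E\smallsetminus\{y_i\}$ is the set obtained by deleting the $i$th smallest element. The push-forward $\alpha_i(\mu)$ and $\mu$ are both regarded as probability distributions on the set of all finite subsets of $\mathbf{N}$. The total variation distance is half of the $\ell^1$-distance. *)

theory Defs
  imports "HOL-Probability.Probability"
begin

text \<open>
  The list index is shifted because elements are counted from 1. The value is \<open>E\<close> itself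
  unless \<open>E\<close> is finite and has an \<open>i\<close>-th smallest element.
\<close>
definition del_nth :: "nat \<Rightarrow> nat set \<Rightarrow> nat set" where
  "del_nth i E = (if 1 \<le> i \<and> i \<le> card E then E - {sorted_list_of_set E ! (i - 1)} else E)"

lemma del_nth_eq:
  fixes y :: "nat \<Rightarrow> nat"
  assumes mono: "strict_mono_on {1..n} y" and E: "E = y ` {1..n}" and i: "i \<in> {1..n}"
  shows "del_nth i E = E - {y i}"
proof -
  have card: "card E = n"
    using strict_mono_on_imp_inj_on[OF mono] E by (simp add: card_image)
  have "sorted_wrt (<) (map y [1..<Suc n])"
    using mono by (auto simp: sorted_wrt_iff_nth_less strict_mono_on_def simp del: upt_Suc)
  moreover have "set (map y [1..<Suc n]) = set (sorted_list_of_set E)"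
    using E by (simp add: atLeastLessThanSuc_atLeastAtMost del: upt_Suc)
  ultimately have "sorted_list_of_set E = map y [1..<Suc n]"
    by (intro strict_sorted_equal) simp_all
  then show ?thesis
    using i card by (auto simp: del_nth_def nth_map simp del: upt_Suc)
qed

definition tv_dist :: "'a pmf \<Rightarrow> 'a pmf \<Rightarrow> real" where
  "tv_dist p q = (\<Sum>\<^sub>\<infinity>x. \<bar>pmf p x - pmf q x\<bar>) / 2"

lemma tv_dist_summable: "(\<lambda>x. \<bar>pmf p x - pmf q x\<bar>) summable_on UNIV"
proof -
  have "Infinite_Sum.abs_summable_on (\<lambda>x. pmf p x - pmf q x) UNIV"
    unfolding abs_summable_equivalent
    by (rule abs_summable_on_diff[OF pmf_abs_summable pmf_abs_summable])
  then show ?thesis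
    by simp
qed

end

theory Submission
  imports Defs
begin

text \<open>
  The proof is by induction on \<open>k\<close>. For \<open>k = 1\<close> take the interval \<open>{n..L}\<close> with \<open>n\<close> uniform in
  \<open>{1..L}\<close>. For the step, let \<open>T = {t\<^sub>1 < \<dots> < t\<^sub>m}\<close> be drawn from a distribution that is almost
  invariant under the first \<open>k\<close> deletions, and regard the \<open>t\<^sub>j\<close> as scales: choose \<open>y\<^sub>1\<close> uniformly
  in \<open>{1..M}\<close> and independent gaps \<open>y\<^sub>j\<^sub>+\<^sub>1 - y\<^sub>j\<close> uniformly in \<open>{1..a ^ t\<^sub>j}\<close> for a large \<open>a\<close>.
  Deleting an inner point \<open>y\<^sub>j\<close> merges two adjacent gaps; as the smaller one is negligible against
  the larger one, the merged gap is almost uniform at the larger scale. So this deletion amounts to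
  deleting the scale \<open>t\<^sub>j\<^sub>-\<^sub>1\<close>; this also holds, exactly, for the last point. Deleting \<open>y\<^sub>1\<close>
  amounts to deleting \<open>t\<^sub>1\<close>, provided that \<open>M\<close> is huge. The random set
  \<open>{y\<^sub>1 < \<dots> < y\<^sub>m\<^sub>+\<^sub>1}\<close> is therefore almost invariant under the first \<open>k + 1\<close> deletions.
\<close>

section \<open>Closeness of distributions by test functions\<close>

text \<open>
  Taking indicator functions for \<open>f\<close> shows that this says that the total variation distance is at
  most \<open>e\<close>; it is symmetric in \<open>p\<close> and \<open>q\<close>, since \<open>f\<close> may be replaced by \<open>1 - f\<close>.
\<close>
definition close :: "real \<Rightarrow> 'a pmf \<Rightarrow> 'a pmf \<Rightarrow> bool" where
  "close e p q \<longleftrightarrow> (\<forall>f :: 'a \<Rightarrow> real. (\<forall>x. 0 \<le> f x \<and> f x \<le> 1) \<longrightarrow>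
     measure_pmf.expectation p f \<le> measure_pmf.expectation q f + e)"

lemma closeI:
  assumes "\<And>f :: 'a \<Rightarrow> real. (\<And>x. 0 \<le> f x) \<Longrightarrow> (\<And>x. f x \<le> 1) \<Longrightarrow>
    measure_pmf.expectation p f \<le> measure_pmf.expectation q f + e"
  shows "close e p q"
  using assms unfolding close_def by blast

lemma closeD:
  fixes f :: "'a \<Rightarrow> real"
  assumes "close e p q" "\<And>x. 0 \<le> f x" "\<And>x. f x \<le> 1"
  shows "measure_pmf.expectation p f \<le> measure_pmf.expectation q f + e"
  using assms unfolding close_def by blast

lemma close_refl: "0 \<le> e \<Longrightarrow> close e p p"
  by (simp add: close_def)

lemma close_mono: "close e p q \<Longrightarrow> e \<le> e' \<Longrightarrow> close e' p q"
  unfolding close_def by (meson add_left_mono order_trans)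

lemma close_trans: "close e p q \<Longrightarrow> close e' q r \<Longrightarrow> close (e + e') p r"
  unfolding close_def by (smt (verit, best))

lemma expectation_bind_pmf:
  fixes f :: "'b \<Rightarrow> real"
  assumes "\<And>x. 0 \<le> f x" "\<And>x. f x \<le> 1"
  shows "measure_pmf.expectation (bind_pmf p K) f =
    measure_pmf.expectation p (\<lambda>x. measure_pmf.expectation (K x) f)"
proof -
  have "\<bar>f x\<bar> \<le> 1" for x
    using assms[of x] by simp
  then show ?thesis
    unfolding measure_pmf_bind
    by (intro integral_bind[where K = "count_space UNIV" and B = 1 and B' = 1])
       (auto simp: measure_pmf.emeasure_space_le_1 measurable_measure_pmf
          intro!: measure_pmf_in_subprob_algebra)
qed

lemma expectation_bounds:
  fixes f :: "'a \<Rightarrow> real"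
  assumes "\<And>x. 0 \<le> f x" "\<And>x. f x \<le> 1"
  shows "0 \<le> measure_pmf.expectation p f" "measure_pmf.expectation p f \<le> 1"
    and "integrable (measure_pmf p) f"
proof -
  show int: "integrable (measure_pmf p) f"
    using assms by (intro measure_pmf.integrable_const_bound[where B = 1]) auto
  show "0 \<le> measure_pmf.expectation p f"
    using assms by simp
  show "measure_pmf.expectation p f \<le> 1"
    using assms by (intro measure_pmf.integral_le_const int) simp
qed

text \<open>Averaging a test function over the second stage \<open>K\<close> gives a function of the
  first stage that again takes values in [0,1].\<close>

lemma close_bind_left:
  assumes "close e p q"
  shows "close e (bind_pmf p K) (bind_pmf q K)"
  by (intro closeI) (simp add: expectation_bind_pmf closeD[OF assms] expectation_bounds)

lemma close_bind_right:
  assumes "\<And>x. x \<in> set_pmf p \<Longrightarrow> close e (K x) (L x)"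
  shows "close e (bind_pmf p K) (bind_pmf p L)"
proof (rule closeI)
  fix f :: "'b \<Rightarrow> real"
  assume f: "\<And>x. 0 \<le> f x" "\<And>x. f x \<le> 1"
  have int: "integrable (measure_pmf p) (\<lambda>x. measure_pmf.expectation (K x) f)" for K
    by (intro expectation_bounds(3) expectation_bounds(1,2)[OF f])
  have "measure_pmf.expectation (bind_pmf p K) f
      \<le> measure_pmf.expectation p (\<lambda>x. measure_pmf.expectation (L x) f + e)"
    unfolding expectation_bind_pmf[OF f]
    by (intro integral_mono_AE int Bochner_Integration.integrable_add)
       (auto simp: AE_measure_pmf_iff intro!: closeD[OF assms f])
  also have "\<dots> = measure_pmf.expectation (bind_pmf p L) f + e"
    using int[of L] by (simp add: expectation_bind_pmf[OF f])
  finally show "measure_pmf.expectation (bind_pmf p K) f \<le> measure_pmf.expectation (bind_pmf p L) f + e" .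
qed

lemma close_map:
  assumes "close e p q"
  shows "close e (map_pmf g p) (map_pmf g q)"
  unfolding map_pmf_def by (rule close_bind_left[OF assms])

lemma tv_dist_le_if_close:
  assumes "close e p q" "finite (set_pmf p)" "finite (set_pmf q)"
  shows "tv_dist p q \<le> e"
proof -
  define S where "S = set_pmf p \<union> set_pmf q"
  have fin: "finite S"
    using assms by (simp add: S_def)
  \<comment> \<open>The optimal test function: the indicator of the points where \<open>p\<close>
    has more mass than \<open>q\<close>.\<close>
  define f :: "'a \<Rightarrow> real" where "f = (\<lambda>x. of_bool (pmf q x < pmf p x))"
  have E: "measure_pmf.expectation r f = (\<Sum>x\<in>S. f x * pmf r x)" if "set_pmf r \<subseteq> S" for r
    using that fin by (subst integral_measure_pmf[of S]) (auto simp: mult.commute)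
  have "(\<Sum>\<^sub>\<infinity>x. \<bar>pmf p x - pmf q x\<bar>) = (\<Sum>\<^sub>\<infinity>x\<in>S. \<bar>pmf p x - pmf q x\<bar>)"
    by (intro infsum_cong_neutral) (auto simp: S_def set_pmf_iff)
  \<comment> \<open>An absolute value is twice the positive part minus the number itself; the latter
    sums to 0, both total masses being 1.\<close>
  also have "\<dots> = (\<Sum>x\<in>S. 2 * (f x * pmf p x - f x * pmf q x) - (pmf p x - pmf q x))"
    using fin by (auto simp: f_def intro!: sum.cong)
  also have "\<dots> = 2 * (measure_pmf.expectation p f - measure_pmf.expectation q f)
      - ((\<Sum>x\<in>S. pmf p x) - (\<Sum>x\<in>S. pmf q x))"
    by (subst (1 2) E) (auto simp: S_def sum_subtractf sum_distrib_left)
  also have "(\<Sum>x\<in>S. pmf p x) - (\<Sum>x\<in>S. pmf q x) = 0"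
    using fin by (simp add: sum_pmf_eq_1 S_def)
  finally show ?thesis
    using closeD[OF assms(1), of f] by (simp add: tv_dist_def f_def)
qed

text \<open>At most \<open>d\<close> points of the shifted interval lie outside
  \<open>{1..n}\<close>, each of mass \<open>1 / n\<close>. Every error in the construction comes
  from this bound.\<close>

lemma close_uniform_shift:
  fixes n d :: nat
  assumes "n > 0" "real d \<le> e * real n"
  shows "close e (map_pmf (\<lambda>x. x + d) (pmf_of_set {1..n})) (pmf_of_set {1..n})"
proof (rule closeI)
  fix f :: "nat \<Rightarrow> real"
  assume f: "\<And>x. 0 \<le> f x" "\<And>x. f x \<le> 1"
  have "(\<Sum>x = 1..n. f (x + d)) = (\<Sum>x = 1 + d..n + d. f x)"
    by (rule sum.shift_bounds_cl_nat_ivl[symmetric])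
  also have "\<dots> \<le> (\<Sum>x\<in>{1..n} \<union> {n + 1..n + d}. f x)"
    using f by (intro sum_mono2) auto
  also have "\<dots> = (\<Sum>x = 1..n. f x) + (\<Sum>x = n + 1..n + d. f x)"
    by (rule sum.union_disjoint) auto
  also have "(\<Sum>x = n + 1..n + d. f x) \<le> real (card {n + 1..n + d}) * 1"
    using f by (intro sum_bounded_above) auto
  finally have "(\<Sum>x = 1..n. f (x + d)) \<le> (\<Sum>x = 1..n. f x) + real d"
    by simp
  then have "(\<Sum>x = 1..n. f (x + d)) / n \<le> ((\<Sum>x = 1..n. f x) + e * n) / n"
    using assms(2) by (intro divide_right_mono) linarith+
  also have "\<dots> = (\<Sum>x = 1..n. f x) / n + e"
    using assms(1) by (simp add: add_divide_distrib)
  finally show "measure_pmf.expectation (map_pmf (\<lambda>x. x + d) (pmf_of_set {1..n})) f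
      \<le> measure_pmf.expectation (pmf_of_set {1..n}) f + e"
    using assms(1) by (simp add: integral_pmf_of_set)
qed

section \<open>Deletion from increasing lists\<close>

text \<open>Positions count from 0, and the recursion matches that of \<open>gaps_pmf\<close>;
  \<open>del_nth_set\<close> translates back to sets.\<close>

fun del_at :: "nat \<Rightarrow> 'a list \<Rightarrow> 'a list" where
  "del_at i [] = []"
| "del_at 0 (x # xs) = xs"
| "del_at (Suc i) (x # xs) = x # del_at i xs"

lemma set_del_at:
  assumes "distinct xs" "i < length xs"
  shows "set (del_at i xs) = set xs - {xs ! i}"
  using assms
proof (induction i xs rule: del_at.induct)
  case (3 i x xs)
  have "i < length xs" "x \<notin> set xs" "distinct xs"
    using "3.prems" by simp_all
  moreover from this have "x \<noteq> xs ! i"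
    using nth_mem[of i xs] by metis
  moreover have "set (del_at i xs) = set xs - {xs ! i}"
    by (rule "3.IH") fact+
  ultimately show ?case
    by (simp only: del_at.simps list.set nth_Cons_Suc insert_Diff_if) simp
next
  case (2 x xs)
  then show ?case
    by (simp only: del_at.simps list.set nth_Cons_0 distinct.simps) blast
qed simp

lemma del_nth_set:
  assumes "sorted_wrt (<) xs" "i < length xs"
  shows "del_nth (Suc i) (set xs) = set (del_at i xs)"
proof -
  have "distinct xs" and "sorted_list_of_set (set xs) = xs"
    using assms(1) by (simp_all add: strict_sorted_iff sorted_list_of_set.idem_if_sorted_distinct)
  then show ?thesis
    unfolding del_nth_def using assms(2) set_del_at[of xs i] distinct_card[of xs] by simp
qed

section \<open>Random points with gaps of prescribed scales\<close>

text \<open>The starting point is a parameter, so that the recursion can pass on the point reached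
  so far. There is one more point than there are scales, which is how the induction gains an
  element.\<close>

fun gaps_pmf :: "nat \<Rightarrow> nat \<Rightarrow> nat list \<Rightarrow> nat list pmf" where
  "gaps_pmf a y [] = return_pmf [y]"
| "gaps_pmf a y (t # ts) =
    bind_pmf (pmf_of_set {1..a ^ t}) (\<lambda>d. map_pmf ((#) y) (gaps_pmf a (y + d) ts))"

definition points_pmf :: "nat \<Rightarrow> nat \<Rightarrow> nat list \<Rightarrow> nat list pmf" where
  "points_pmf a M ts = bind_pmf (pmf_of_set {1..M}) (\<lambda>y. gaps_pmf a y ts)"

lemma set_pmf_uniform: "n > 0 \<Longrightarrow> set_pmf (pmf_of_set {1..n}) = {1..n}" for n :: nat
  by (rule set_pmf_of_set) auto

lemma finite_set_gaps_pmf: "a > 0 \<Longrightarrow> finite (set_pmf (gaps_pmf a y ts))"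
  by (induction ts arbitrary: y) (simp_all add: set_pmf_uniform del: One_nat_def)

lemma set_gaps_pmf:
  assumes "a > 0" "xs \<in> set_pmf (gaps_pmf a y ts)"
  shows "sorted_wrt (<) xs \<and> set xs \<subseteq> {y..} \<and> length xs = Suc (length ts)"
  using assms(2)
proof (induction ts arbitrary: y xs)
  case (Cons t ts)
  then obtain d ys where "d \<ge> 1" "ys \<in> set_pmf (gaps_pmf a (y + d) ts)" "xs = y # ys"
    using assms(1) by (auto simp: set_pmf_uniform simp del: One_nat_def)
  with Cons.IH[of ys "y + d"] show ?case
    by force
qed simp

lemma map_tl_gaps_pmf:
  "map_pmf (del_at 0) (gaps_pmf a y (t # ts)) =
    bind_pmf (pmf_of_set {1..a ^ t}) (\<lambda>d. gaps_pmf a (y + d) ts)"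
  by (simp add: map_bind_pmf pmf.map_comp o_def)

section \<open>Deleting a point against deleting a scale\<close>

lemma close_del_gaps_pmf:
  assumes "a > 0" "sorted_wrt (<) ts" "i < length ts"
  shows "close (1 / a) (map_pmf (del_at (Suc i)) (gaps_pmf a y ts)) (gaps_pmf a y (del_at i ts))"
  using assms(2,3)
proof (induction i ts arbitrary: y rule: del_at.induct)
  case (2 t ts)
  show ?case
  proof (cases ts)
    \<comment> \<open>The last point takes its gap with it, so there is no error.\<close>
    case Nil
    then show ?thesis
      by (simp add: map_bind_pmf close_refl)
  next
    case (Cons t' us)
    define U where "U t = pmf_of_set {1..a ^ t}" for t
    define K where "K x = map_pmf ((#) y) (gaps_pmf a (y + x) us)" for x
    have set_U: "set_pmf (U t) = {1..a ^ t}"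
      using assms(1) by (simp add: U_def)
    \<comment> \<open>Given the smaller gap \<open>d\<close>, the merged gap is a uniform gap of
      scale \<open>t'\<close> shifted by \<open>d\<close>, and \<open>d\<close> is at most
      \<open>1 / a\<close> times the range of that gap.\<close>
    have eq1: "map_pmf (del_at (Suc 0)) (gaps_pmf a y (t # ts)) =
        bind_pmf (U t) (\<lambda>d. bind_pmf (map_pmf (\<lambda>x. x + d) (U t')) K)"
      using Cons by (simp add: map_bind_pmf bind_map_pmf pmf.map_comp o_def U_def K_def ac_simps)
    have eq2: "gaps_pmf a y (del_at 0 (t # ts)) = bind_pmf (U t) (\<lambda>d. bind_pmf (U t') K)"
      using Cons by (simp add: U_def K_def[abs_def])
    have "close (1 / a) (map_pmf (\<lambda>x. x + d) (U t')) (U t')" if "d \<in> set_pmf (U t)" for d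
    proof -
      have "Suc t \<le> t'"
        using 2 Cons by auto
      then have "a ^ Suc t \<le> a ^ t'"
        using assms(1) by (intro power_increasing) auto
      moreover have "d \<le> a ^ t"
        using that set_U by simp
      ultimately have "d * a \<le> a ^ t'"
        by (metis mult.commute mult_le_mono2 order_trans power_Suc)
      then have "real d * real a \<le> real a ^ t'"
        by (metis of_nat_le_iff of_nat_mult of_nat_power)
      then show ?thesis
        unfolding U_def using assms(1) by (intro close_uniform_shift) (auto simp: field_simps)
    qed
    then show ?thesis
      unfolding eq1 eq2 by (intro close_bind_right close_bind_left)
  qed
next
  case (3 i t ts)
  then have "close (1 / a) (map_pmf ((#) y) (map_pmf (del_at (Suc i)) (gaps_pmf a z ts)))
      (map_pmf ((#) y) (gaps_pmf a z (del_at i ts)))" for z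
    by (intro close_map) simp
  then show ?case
    by (auto simp: map_bind_pmf pmf.map_comp o_def intro!: close_bind_right)
qed simp

lemma close_tl_points_pmf:
  assumes "a > 0" "a ^ Suc t \<le> M"
  shows "close (1 / a) (map_pmf (del_at 0) (points_pmf a M (t # ts))) (points_pmf a M ts)"
proof -
  define U where "U = pmf_of_set {1..M}"
  define V where "V = pmf_of_set {1..a ^ t}"
  have "M > 0"
    using assms by (metis gr0I not_less zero_less_power)
  have "map_pmf (del_at 0) (points_pmf a M (t # ts)) =
      bind_pmf U (\<lambda>y. bind_pmf V (\<lambda>d. gaps_pmf a (y + d) ts))"
    unfolding points_pmf_def map_bind_pmf map_tl_gaps_pmf U_def V_def ..
  \<comment> \<open>Drawing the first gap \<open>d\<close> before the starting point turns the
    deletion into a shift of the uniform starting point by a fixed \<open>d\<close>.\<close>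
  also have "\<dots> = bind_pmf V (\<lambda>d. bind_pmf (map_pmf (\<lambda>y. y + d) U) (\<lambda>y. gaps_pmf a y ts))"
    by (subst bind_commute_pmf) (simp add: bind_map_pmf)
  finally have 1: "map_pmf (del_at 0) (points_pmf a M (t # ts)) = \<dots>" .
  have 2: "points_pmf a M ts = bind_pmf V (\<lambda>d. bind_pmf U (\<lambda>y. gaps_pmf a y ts))"
    by (simp add: points_pmf_def U_def)
  have "close (1 / a) (map_pmf (\<lambda>y. y + d) U) U" if "d \<in> set_pmf V" for d
  proof -
    have "d \<le> a ^ t"
      using that assms(1) by (simp add: V_def)
    then have "d * a \<le> M"
      using assms(2) by (metis mult.commute mult_le_mono2 order_trans power_Suc)
    then have "real d * real a \<le> real M"
      by (metis of_nat_le_iff of_nat_mult)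
    then show ?thesis
      unfolding U_def using assms(1) \<open>M > 0\<close> by (intro close_uniform_shift) (auto simp: field_simps)
  qed
  then show ?thesis
    unfolding 1 2 by (intro close_bind_right close_bind_left)
qed

text \<open>For \<open>i = 0\<close> the truncated \<open>i - 1\<close> is 0: deleting either of the
  first two points amounts to deleting the first scale.\<close>

lemma close_del_points_pmf:
  assumes "a > 0" "sorted_wrt (<) ts" "ts \<noteq> []" "i \<le> length ts" "\<And>t. t \<in> set ts \<Longrightarrow> a ^ Suc t \<le> M"
  shows "close (1 / a) (map_pmf (del_at i) (points_pmf a M ts)) (points_pmf a M (del_at (i - 1) ts))"
proof (cases i)
  case 0
  then show ?thesis
    using assms close_tl_points_pmf by (cases ts) auto
next
  case (Suc j)
  then show ?thesis
    unfolding points_pmf_def map_bind_pmf using assms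
    by (auto intro!: close_bind_right close_del_gaps_pmf)
qed

section \<open>The induction on the number of deletions\<close>

lemma ex_almost_invariant_pmf:
  assumes "k \<ge> 1" "e > 0"
  shows "\<exists>\<mu> :: nat list pmf. finite (set_pmf \<mu>) \<and>
    (\<forall>xs \<in> set_pmf \<mu>. sorted_wrt (<) xs \<and> set xs \<subseteq> {1..} \<and> length xs \<ge> k) \<and>
    (\<forall>i < k. close e (map_pmf (del_at i) \<mu>) \<mu>)"
  using assms
proof (induction k arbitrary: e rule: dec_induct)
  case base
  obtain L :: nat where L: "L > 0" "1 / real L < e"
    using base by (metis nat_approx_posE zero_less_Suc)
  define U where "U = pmf_of_set {1..L}"
  define \<mu> where "\<mu> = map_pmf (\<lambda>n. [n..<Suc L]) U"
  have set_U: "set_pmf U = {1..L}"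
    using L by (simp add: U_def)
  \<comment> \<open>Removing the left endpoint shifts \<open>n\<close> by 1. For
    \<open>n = L\<close> both sides give the empty list.\<close>
  have "map_pmf (del_at 0) \<mu> = map_pmf (\<lambda>n. [n..<Suc L]) (map_pmf (\<lambda>x. x + 1) U)"
    unfolding \<mu>_def pmf.map_comp o_def
    by (rule map_pmf_cong) (auto simp: set_U upt_conv_Cons simp del: upt_Suc)
  moreover have "close e (map_pmf (\<lambda>x. x + 1) U) U"
    unfolding U_def using L by (intro close_uniform_shift) (auto simp: field_simps)
  ultimately have "close e (map_pmf (del_at 0) \<mu>) \<mu>"
    using close_map unfolding \<mu>_def by metis
  then show ?case
    by (intro exI[of _ \<mu>]) (auto simp: \<mu>_def set_U simp del: upt_Suc)
next
  case (step k)
  obtain a :: nat where a: "a > 0" "1 / real a < e / 2"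
    using step.prems by (metis half_gt_zero nat_approx_posE zero_less_Suc)
  obtain \<mu> :: "nat list pmf" where fin: "finite (set_pmf \<mu>)"
    and \<mu>: "\<And>xs. xs \<in> set_pmf \<mu> \<Longrightarrow> sorted_wrt (<) xs \<and> set xs \<subseteq> {1..} \<and> length xs \<ge> k"
    and inv: "\<And>i. i < k \<Longrightarrow> close (e / 2) (map_pmf (del_at i) \<mu>) \<mu>"
    using step.IH[of "e / 2"] step.prems by auto
  \<comment> \<open>\<open>B\<close> bounds all scales in the support, so that \<open>M\<close> is
    at least \<open>a\<close> times any possible gap.\<close>
  define B where "B = Max (insert 0 (\<Union>xs \<in> set_pmf \<mu>. set xs))"
  define M where "M = a ^ Suc B"
  have M: "a ^ Suc t \<le> M" if "xs \<in> set_pmf \<mu>" "t \<in> set xs" for xs t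
  proof -
    have "t \<le> B"
      unfolding B_def using fin that by (intro Max_ge) auto
    then show ?thesis
      unfolding M_def using a by (intro power_increasing) auto
  qed
  have "M > 0"
    using a by (simp add: M_def)
  define \<nu> where "\<nu> = bind_pmf \<mu> (points_pmf a M)"
  have "finite (set_pmf \<nu>)"
    using fin a \<open>M > 0\<close> by (auto simp: \<nu>_def points_pmf_def finite_set_gaps_pmf)
  moreover have "sorted_wrt (<) xs \<and> set xs \<subseteq> {1..} \<and> length xs \<ge> Suc k" if xs: "xs \<in> set_pmf \<nu>" for xs
  proof -
    obtain ts y where "ts \<in> set_pmf \<mu>" "y \<ge> 1" "xs \<in> set_pmf (gaps_pmf a y ts)"
      using xs \<open>M > 0\<close>
      by (auto simp: \<nu>_def points_pmf_def set_pmf_uniform simp del: One_nat_def)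
    with set_gaps_pmf[OF a(1), of xs y ts] \<mu>[of ts] show ?thesis
      by auto
  qed
  moreover have "close e (map_pmf (del_at i) \<nu>) \<nu>" if "i < Suc k" for i
  proof -
    \<comment> \<open>First trade the deleted point for a deleted scale, at cost
      \<open>1 / a\<close>; then use the invariance of \<open>\<mu>\<close>, which applies since
      \<open>i - 1 < k\<close>, also for \<open>i = 0\<close> because
      \<open>k \<ge> 1\<close>.\<close>
    have "close (1 / a) (map_pmf (del_at i) \<nu>)
        (bind_pmf \<mu> (\<lambda>ts. points_pmf a M (del_at (i - 1) ts)))"
      unfolding \<nu>_def map_bind_pmf
    proof (intro close_bind_right close_del_points_pmf)
      fix ts assume "ts \<in> set_pmf \<mu>"
      with \<mu>[of ts] step.hyps that show "ts \<noteq> []" "i \<le> length ts" "sorted_wrt (<) ts"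
        by auto
    qed (use a M in auto)
    moreover have "close (e / 2) (bind_pmf (map_pmf (del_at (i - 1)) \<mu>) (points_pmf a M)) \<nu>"
      unfolding \<nu>_def using that step.hyps by (intro close_bind_left inv) auto
    ultimately have "close (1 / a + e / 2) (map_pmf (del_at i) \<nu>) \<nu>"
      by (auto simp: bind_map_pmf intro: close_trans)
    then show ?thesis
      using a by (auto intro: close_mono)
  qed
  ultimately show ?case
    by blast
qed

theorem theorem1:
  fixes k :: nat and \<epsilon> :: real
  assumes "k \<ge> 2" and "\<epsilon> > 0"
  shows "\<exists>\<mu> :: nat set pmf.
    finite (set_pmf \<mu>) \<and>
    (\<forall>E \<in> set_pmf \<mu>. finite E \<and> E \<subseteq> {1..} \<and> card E \<ge> k) \<and>
    (\<forall>i \<in> {1..k}. tv_dist (map_pmf (del_nth i) \<mu>) \<mu> \<le> \<epsilon>)"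
proof -
  obtain \<mu> :: "nat list pmf" where fin: "finite (set_pmf \<mu>)"
    and \<mu>: "\<And>xs. xs \<in> set_pmf \<mu> \<Longrightarrow> sorted_wrt (<) xs \<and> set xs \<subseteq> {1..} \<and> length xs \<ge> k"
    and inv: "\<And>i. i < k \<Longrightarrow> close \<epsilon> (map_pmf (del_at i) \<mu>) \<mu>"
    using ex_almost_invariant_pmf[of k \<epsilon>] assms by auto
  have "tv_dist (map_pmf (del_nth i) (map_pmf set \<mu>)) (map_pmf set \<mu>) \<le> \<epsilon>" if i: "i \<in> {1..k}" for i
  proof -
    obtain j where j: "i = Suc j" "j < k"
      using i by (cases i) auto
    have "map_pmf (del_nth i) (map_pmf set \<mu>) = map_pmf set (map_pmf (del_at j) \<mu>)"
      unfolding pmf.map_comp o_def j using \<mu> j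
      by (intro map_pmf_cong refl del_nth_set) (auto intro: less_le_trans)
    then show ?thesis
      using fin by (auto intro!: tv_dist_le_if_close close_map inv j)
  qed
  moreover have "card (set xs) \<ge> k" if "xs \<in> set_pmf \<mu>" for xs
    using \<mu>[OF that] by (auto simp: strict_sorted_iff distinct_card)
  ultimately show ?thesis
    using fin \<mu> by (intro exI[of _ "map_pmf set \<mu>"]) auto
qed

end
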